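(* Let $(X,\rho,W)$ be a hyperbolic space, $C\subseteq X$ a nonempty convex subset, $(M,d)$ a metric space with the AFPP for nonexpansive mappings, $H:=(C\times M)_\infty$, $\delta:M\to C$ a nonexpansive function, and $T:H\to H$ a nonexpansive function. For $u\in M$ let $T_u:C\to C$, $T_u(x)=(P_1\circ T)(x,u)$. Let $(\lambda_n)_{n\in\mathbb{N}}$ be a sequence in $[0,1)$, and let $K\in\mathbb{N}$, $\alpha:\mathbb{N}\to\mathbb{N}$ be such that for all $n\in\mathbb{N}$, $\lambda_n\le 1-\frac1K$ and $n\le\sum_{i=0}^{\alpha(n)}\lambda_i$. Assume that there is $b>0$ such that $$\forall u\in M\ \exists y\in C\ \Big(\rho(\delta(u),y)\le b\ \wedge\ \forall m,p\in\mathbb{N}\ \big(\rho(y^u_m,y^u_p)\le b\big)\Big),$$ where $(y^u_n)_{n\in\mathbb{N}}$ is the Krasnoselski-Mann iteration starting from $y$ associated with $T_u$ (and $(\lambda_n)$). Then $r_H(T)=0$.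
   Context: A hyperbolic space is a triple $(X,\rho,W)$ where $(X,\rho)$ is a metric space and $W:X\times X\times[0,1]\to X$ satisfies, for all $x,y,z,w\in X$ and $\lambda,\tilde\lambda\in[0,1]$: (W1) $\rho(z,W(x,y,\lambda))\le(1-\lambda)\rho(z,x)+\lambda\rho(z,y)$; (W2) $\rho(W(x,y,\lambda),W(x,y,\tilde\lambda))=|\lambda-\tilde\lambda|\,\rho(x,y)$; (W3) $W(x,y,\lambda)=W(y,x,1-\lambda)$; (W4) $\rho(W(x,z,\lambda),W(y,w,\lambda))\le(1-\lambda)\rho(x,y)+\lambda\rho(z,w)$. Write $(1-\lambda)x\oplus\lambda y$ for $W(x,y,\lambda)$. A subset $C\subseteq X$ is convex if $W(x,y,\lambda)\in C$ for all $x,y\in C$, $\lambda\in[0,1]$. A map $T$ between metric spaces is nonexpansive if it does not increase distances (1-Lipschitz). For a self-map $T:Y\to Y$ of a metric space $(Y,\rho)$, $r_Y(T):=\inf\{\rho(y,T(y)) : y\in Y\}$. A metric space $Y$ has the approximate fixed point property (AFPP) for nonexpansive mappings if every nonexpansive $T:Y\to Y$ admits a sequence $(u_n)$ in $Y$ with $\rho(u_n,T(u_n))\to0$ (equivalently $r_Y(T)=0$). $(C\times M)_\infty$ is the set $C\times M$ with the metric $d_\infty((x,u),(y,v))=\max\{\rho(x,y),d(u,v)\}$. $P_1:H\to C$ is the coordinate projection onto $C$. Each $T_u$ is nonexpansive. The Krasnoselski-Mann iteration starting from $y\in C$ associated with $T_u$ is $y_0^u:=y$, $y^u_{n+1}:=(1-\lambda_n)y^u_n\oplus\lambda_nT_u(y^u_n)$.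 *)

theory Defs
  imports "HOL-Analysis.Analysis"
begin

text \<open>In \<open>W x y t\<close> the parameter \<open>t\<close> is the weight of the second point, i.e.
  \<open>W x y t\<close> stands for the convex combination \<open>(1 - t) x \<oplus> t y\<close>.\<close>

locale hyperbolic_space = Metric_space X \<rho>
  for X :: "'a set" and \<rho> :: "'a \<Rightarrow> 'a \<Rightarrow> real" +
  fixes W :: "'a \<Rightarrow> 'a \<Rightarrow> real \<Rightarrow> 'a"
  assumes W_closed: "\<lbrakk>x \<in> X; y \<in> X; t \<in> {0..1}\<rbrakk> \<Longrightarrow> W x y t \<in> X"
    and W1: "\<lbrakk>x \<in> X; y \<in> X; z \<in> X; t \<in> {0..1}\<rbrakk>
      \<Longrightarrow> \<rho> z (W x y t) \<le> (1 - t) * \<rho> z x + t * \<rho> z y"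
    and W2: "\<lbrakk>x \<in> X; y \<in> X; t \<in> {0..1}; s \<in> {0..1}\<rbrakk>
      \<Longrightarrow> \<rho> (W x y t) (W x y s) = \<bar>t - s\<bar> * \<rho> x y"
    and W3: "\<lbrakk>x \<in> X; y \<in> X; t \<in> {0..1}\<rbrakk> \<Longrightarrow> W x y t = W y x (1 - t)"
    and W4: "\<lbrakk>x \<in> X; y \<in> X; z \<in> X; w \<in> X; t \<in> {0..1}\<rbrakk>
      \<Longrightarrow> \<rho> (W x z t) (W y w t) \<le> (1 - t) * \<rho> x y + t * \<rho> z w"

definition W_convex :: "('a \<Rightarrow> 'a \<Rightarrow> real \<Rightarrow> 'a) \<Rightarrow> 'a set \<Rightarrow> bool" where
  "W_convex W C \<longleftrightarrow> (\<forall>x\<in>C. \<forall>y\<in>C. \<forall>t\<in>{0..1}. W x y t \<in> C)"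

definition nonexpansive ::
  "'a set \<Rightarrow> ('a \<Rightarrow> 'a \<Rightarrow> real) \<Rightarrow> 'b set \<Rightarrow> ('b \<Rightarrow> 'b \<Rightarrow> real) \<Rightarrow> ('a \<Rightarrow> 'b) \<Rightarrow> bool" where
  "nonexpansive Y d Z e f \<longleftrightarrow>
     f \<in> Y \<rightarrow> Z \<and> (\<forall>x\<in>Y. \<forall>y\<in>Y. e (f x) (f y) \<le> d x y)"

text \<open>The quantity written \<open>r\<^sub>Y(T)\<close>. It is meaningful for nonempty \<open>Y\<close> only, because the infimum
  is taken in the reals.\<close>

definition min_displacement :: "'a set \<Rightarrow> ('a \<Rightarrow> 'a \<Rightarrow> real) \<Rightarrow> ('a \<Rightarrow> 'a) \<Rightarrow> real" where
  "min_displacement Y d T = (INF y\<in>Y. d y (T y))"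

text \<open>The approximate fixed point property for nonexpansive mappings; it forces \<open>Y\<close> to be nonempty.\<close>

definition AFPP :: "'a set \<Rightarrow> ('a \<Rightarrow> 'a \<Rightarrow> real) \<Rightarrow> bool" where
  "AFPP Y d \<longleftrightarrow>
     (\<forall>T. nonexpansive Y d Y d T \<longrightarrow>
        (\<exists>u :: nat \<Rightarrow> 'a. range u \<subseteq> Y \<and> (\<lambda>n. d (u n) (T (u n))) \<longlonglongrightarrow> 0))"

text \<open>The maximum metric has to be passed explicitly: the type class metric on pairs is the
  Euclidean combination.\<close>

definition dist_max ::
  "('a \<Rightarrow> 'a \<Rightarrow> real) \<Rightarrow> ('b \<Rightarrow> 'b \<Rightarrow> real) \<Rightarrow> 'a \<times> 'b \<Rightarrow> 'a \<times> 'b \<Rightarrow> real" where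
  "dist_max \<rho> d p q = max (\<rho> (fst p) (fst q)) (d (snd p) (snd q))"

definition slice_map :: "('a \<times> 'b \<Rightarrow> 'a \<times> 'b) \<Rightarrow> 'b \<Rightarrow> 'a \<Rightarrow> 'a" where
  "slice_map T u x = (fst \<circ> T) (x, u)"

primrec KM_iteration ::
  "('a \<Rightarrow> 'a \<Rightarrow> real \<Rightarrow> 'a) \<Rightarrow> (nat \<Rightarrow> real) \<Rightarrow> ('a \<Rightarrow> 'a) \<Rightarrow> 'a \<Rightarrow> nat \<Rightarrow> 'a" where
  "KM_iteration W l S y 0 = y"
| "KM_iteration W l S y (Suc n) =
     W (KM_iteration W l S y n) (S (KM_iteration W l S y n)) (l n)"

end

theory Submission
  imports Defs
begin

text \<open>Let \<open>x\<^sub>n(u)\<close> be the Krasnoselski-Mann iteration of \<open>T\<^sub>u\<close> started at \<open>\<delta>(u)\<close>. For each fixed \<open>n\<close> the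
  map \<open>u \<mapsto> (x\<^sub>n(u), u)\<close> is nonexpansive, so the AFPP applied to the second component of
  \<open>T (x\<^sub>n(u), u)\<close> makes the displacement in \<open>M\<close> small for some \<open>u\<close>. The displacement in \<open>C\<close> is made
  small by choosing \<open>n\<close> beforehand, uniformly in \<open>u\<close>: the iteration stays within distance \<open>b\<close> of
  the bounded one started at \<open>y\<close>, hence is bounded by \<open>3 b\<close>, and the inequality of Goebel and Kirk
  shows that, along every block of indices on which the \<open>\<lambda>\<close>'s sum to about a large constant, the
  displacement is either already small or drops by a fixed amount. As it is bounded, the number
  of blocks needed depends only on \<open>b\<close> and the sequence \<open>\<lambda>\<close>.\<close>

section \<open>Estimates for the step sizes\<close>

text \<open>Writing \<open>1 / (1 - t) = 1 + t / (1 - t)\<close> and using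
  \<open>1 / (1 - t) \<le> k\<close> bounds it by an exponential linear in \<open>t\<close>.
  Products of such factors are thus controlled by the sum of the step sizes.\<close>

lemma inverse_one_minus_le_exp:
  fixes t k :: real
  assumes "0 \<le> t" "t \<le> 1 - 1 / k" "0 < k"
  shows "1 / (1 - t) \<le> exp (k * t)"
proof -
  have pos: "0 < 1 - t" using assms by (smt (verit) divide_pos_pos)
  have "1 / (1 - t) = 1 + t / (1 - t)" using pos by (simp add: field_simps)
  also have "\<dots> \<le> exp (t / (1 - t))" by (rule exp_ge_add_one_self)
  also have "t / (1 - t) \<le> k * t"
  proof -
    have "1 \<le> k * (1 - t)" using assms by (simp add: field_simps)
    then have "t * 1 \<le> t * (k * (1 - t))" using assms(1) by (intro mult_left_mono)
    then show ?thesis using pos by (simp add: pos_divide_le_eq mult_ac)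
  qed
  finally show ?thesis by simp
qed

text \<open>In the induction for the Goebel-Kirk inequality this fixes the sign of the coefficient
  of the residual, so that one residual can be replaced by the preceding one.\<close>

lemma one_plus_sum_le_prod_inverse:
  fixes l :: "nat \<Rightarrow> real"
  assumes "\<And>n. l n \<in> {0..<1}"
  shows "1 + sum l {i..<i + n} \<le> (\<Prod>s=i..<i + n. 1 / (1 - l s))"
proof (induction n)
  case (Suc n)
  let ?S = "sum l {i..<i + n}" and ?P = "\<Prod>s=i..<i + n. 1 / (1 - l s)" and ?a = "l (i + n)"
  have a: "0 \<le> ?a" "?a < 1" using assms[of "i + n"] by auto
  have S: "0 \<le> ?S" using assms by (intro sum_nonneg) auto
  have "(1 + ?S + ?a) * (1 - ?a) \<le> 1 + ?S"
    using a S by (simp add: algebra_simps)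
  also have "\<dots> \<le> ?P" by (rule Suc.IH)
  finally have "1 + ?S + ?a \<le> ?P / (1 - ?a)"
    using a by (simp add: pos_le_divide_eq)
  then show ?case by (simp add: field_simps)
qed simp

text \<open>The least \<open>n\<close> whose block sum reaches \<open>A\<close> overshoots by less
  than one, because each term is below one. The upper bound matters as much as the lower: it limits
  the product in the Goebel-Kirk inequality.\<close>

lemma exists_block_of_sum:
  fixes l :: "nat \<Rightarrow> real"
  assumes l: "\<And>n. l n \<in> {0..<1}" and div: "\<And>B. \<exists>m. B \<le> sum l {..<m}" and A: "0 \<le> A"
  obtains n where "A \<le> sum l {i..<i + n}" "sum l {i..<i + n} \<le> A + 1"
proof -
  have "\<exists>n. A \<le> sum l {i..<i + n}"
  proof -
    obtain m where m: "A + sum l {..<i} \<le> sum l {..<m}" using div by blast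
    have "sum l {..<m} \<le> sum l {..<i + m}" using l by (intro sum_mono2) auto
    also have "\<dots> = sum l {..<i} + sum l {i..<i + m}"
      by (simp add: lessThan_atLeast0 sum.atLeastLessThan_concat)
    finally show ?thesis using m by (intro exI[of _ m]) simp
  qed
  then obtain n where n: "A \<le> sum l {i..<i + n}"
    and min: "\<And>k. k < n \<Longrightarrow> \<not> A \<le> sum l {i..<i + k}"
    using exists_least_iff[of "\<lambda>n. A \<le> sum l {i..<i + n}"] by blast
  have "sum l {i..<i + n} \<le> A + 1"
  proof (cases n)
    case 0
    then show ?thesis using A by simp
  next
    case (Suc k)
    then have "sum l {i..<i + k} < A" using min[of k] by simp
    then show ?thesis using Suc l[of "i + k"] by simp
  qed
  then show ?thesis using n that by blast
qed

section \<open>Krasnoselski-Mann iterations of a single nonexpansive map\<close>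

locale KM_setting = hyperbolic_space X \<rho> W
  for X :: "'a set" and \<rho> and W +
  fixes C :: "'a set" and S :: "'a \<Rightarrow> 'a" and l :: "nat \<Rightarrow> real"
  assumes C_subset: "C \<subseteq> X" and C_convex: "W_convex W C"
    and S_nonexpansive: "nonexpansive C \<rho> C \<rho> S"
    and l_range: "l n \<in> {0..<1}"
begin

lemma l_unit: "l n \<in> {0..1}"
  using l_range[of n] by simp

lemma S_closed: "x \<in> C \<Longrightarrow> S x \<in> C"
  using S_nonexpansive by (auto simp: nonexpansive_def)

lemma S_le: "x \<in> C \<Longrightarrow> y \<in> C \<Longrightarrow> \<rho> (S x) (S y) \<le> \<rho> x y"
  using S_nonexpansive by (auto simp: nonexpansive_def)

abbreviation "km \<equiv> KM_iteration W l S"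

definition residual :: "'a \<Rightarrow> nat \<Rightarrow> real" where
  "residual x n = \<rho> (km x n) (S (km x n))"

lemma km_closed: "x \<in> C \<Longrightarrow> km x n \<in> C"
proof (induction n)
  case (Suc n)
  then show ?case using C_convex S_closed l_unit[of n] by (simp add: W_convex_def)
qed simp

lemma km_in_X: "x \<in> C \<Longrightarrow> km x n \<in> X" "x \<in> C \<Longrightarrow> S (km x n) \<in> X"
  using km_closed S_closed C_subset by blast+

lemma residual_nonneg: "0 \<le> residual x n"
  by (simp add: residual_def)

text \<open>By \<open>W4\<close>, each iteration step is nonexpansive in the starting point. This
  transfers boundedness from one starting point to another.\<close>

lemma km_dist_le:
  assumes "x \<in> C" "y \<in> C"
  shows "\<rho> (km x n) (km y n) \<le> \<rho> x y"
proof (induction n)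
  case (Suc n)
  have "\<rho> (km x (Suc n)) (km y (Suc n))
      \<le> (1 - l n) * \<rho> (km x n) (km y n) + l n * \<rho> (S (km x n)) (S (km y n))"
    using W4 km_in_X assms l_unit by simp
  also have "\<dots> \<le> (1 - l n) * \<rho> x y + l n * \<rho> x y"
    using l_unit[of n] Suc S_le[OF km_closed km_closed, OF assms, of n n]
    by (intro add_mono mult_left_mono) auto
  finally show ?case by (simp add: algebra_simps)
qed simp

lemma km_step_eq:
  assumes "x \<in> C"
  shows "\<rho> (km x n) (km x (Suc n)) = l n * residual x n"
proof -
  have x: "km x n \<in> X" "S (km x n) \<in> X" using km_in_X assms by auto
  \<comment> \<open>Weight zero returns the first point, by \<open>W1\<close> measured from that
    point. \<open>W2\<close> between the weights \<open>0\<close> and \<open>l n\<close> then gives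
    the exact step length.\<close>
  have 0: "W (km x n) (S (km x n)) 0 = km x n"
  proof -
    have "\<rho> (km x n) (W (km x n) (S (km x n)) 0) \<le> 0"
      using W1[of "km x n" "S (km x n)" "km x n" 0] x by simp
    then show ?thesis using x W_closed[of "km x n" "S (km x n)" 0]
      by (metis atLeastAtMost_iff nonneg order.antisym order.refl zero zero_le_one)
  qed
  then show ?thesis
    using W2[of "km x n" "S (km x n)" 0 "l n"] x l_unit[of n] by (simp add: residual_def)
qed

text \<open>The new point is within \<open>(1 - l n) * residual x n\<close> of the old image, and
  the image itself moves by at most the step length \<open>l n * residual x n\<close>.\<close>

lemma residual_Suc_le:
  assumes "x \<in> C"
  shows "residual x (Suc n) \<le> residual x n"
proof -
  have x: "km x n \<in> X" "S (km x n) \<in> X" "km x (Suc n) \<in> X" "S (km x (Suc n)) \<in> X"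
    using km_in_X assms by blast+
  have "residual x (Suc n) \<le> \<rho> (km x (Suc n)) (S (km x n)) + \<rho> (S (km x n)) (S (km x (Suc n)))"
    unfolding residual_def using x triangle by blast
  also have "\<rho> (km x (Suc n)) (S (km x n)) \<le> (1 - l n) * residual x n"
    using W1[of "km x n" "S (km x n)" "S (km x n)" "l n"] x l_unit[of n]
    by (simp add: residual_def commute)
  also have "\<rho> (S (km x n)) (S (km x (Suc n))) \<le> l n * residual x n"
    using S_le[OF km_closed km_closed, OF assms assms, of n "Suc n"] km_step_eq[OF assms, of n]
    by linarith
  finally show ?thesis by (simp add: algebra_simps)
qed

lemma residual_antimono: "x \<in> C \<Longrightarrow> m \<le> n \<Longrightarrow> residual x n \<le> residual x m"
  using lift_Suc_antimono_le[of "residual x"] residual_Suc_le by blast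

lemma km_dist_le_sum:
  assumes "x \<in> C"
  shows "\<rho> (km x i) (km x (i + n)) \<le> sum l {i..<i + n} * residual x i"
proof (induction n)
  case 0
  then show ?case using km_in_X assms by simp
next
  case (Suc n)
  have "\<rho> (km x i) (km x (i + Suc n))
      \<le> \<rho> (km x i) (km x (i + n)) + \<rho> (km x (i + n)) (km x (Suc (i + n)))"
    using triangle km_in_X(1)[OF assms] by (metis add_Suc_right)
  also have "\<rho> (km x (i + n)) (km x (Suc (i + n))) \<le> l (i + n) * residual x i"
    using km_step_eq[OF assms, of "i + n"] residual_antimono[OF assms, of i "i + n"]
      l_unit[of "i + n"] by (simp add: mult_left_mono)
  also note Suc.IH
  finally show ?case by (simp add: algebra_simps)
qed

text \<open>The induction removes the first index of the block and keeps the endpoint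
  \<open>i + Suc n\<close>, so the hypothesis is used at \<open>Suc i\<close>; hence
  \<open>i\<close> is arbitrary. \<open>W1\<close> expresses the distance from the next iterate
  through the distance \<open>D\<close> from the current one.\<close>

theorem Goebel_Kirk_inequality:
  assumes x: "x \<in> C"
  shows "(1 + sum l {i..<i + n}) * residual x i
      \<le> \<rho> (km x i) (S (km x (i + n)))
        + (\<Prod>s=i..<i + n. 1 / (1 - l s)) * (residual x i - residual x (i + n))"
proof (induction n arbitrary: i)
  case 0
  then show ?case by (simp add: residual_def)
next
  case (Suc n)
  define a where "a = l i"
  define S' where "S' = sum l {Suc i..<Suc i + n}"
  define P' where "P' = (\<Prod>s=Suc i..<Suc i + n. 1 / (1 - l s))"
  define r where "r = residual x i"
  define r1 where "r1 = residual x (Suc i)"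
  define re where "re = residual x (i + Suc n)"
  define D where "D = \<rho> (km x i) (S (km x (i + Suc n)))"
  have a: "0 \<le> a" "a < 1" using l_range[of i] by (auto simp: a_def)
  have sum_eq: "sum l {i..<i + Suc n} = a + S'"
    by (simp add: a_def S'_def sum.atLeast_Suc_lessThan)
  have prod_eq: "(\<Prod>s=i..<i + Suc n. 1 / (1 - l s)) = P' / (1 - a)"
    unfolding P'_def a_def by (subst prod.atLeast_Suc_lessThan) auto
  have "(1 + S') * r1 \<le> \<rho> (km x (Suc i)) (S (km x (i + Suc n))) + P' * (r1 - re)"
    using Suc.IH[of "Suc i"] by (simp add: S'_def P'_def r1_def re_def)
  also have "\<rho> (km x (Suc i)) (S (km x (i + Suc n)))
      \<le> (1 - a) * D + a * \<rho> (S (km x i)) (S (km x (i + Suc n)))"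
    using W1[OF km_in_X(1)[OF x] km_in_X(2)[OF x] km_in_X(2)[OF x] l_unit[of i]]
    unfolding a_def D_def KM_iteration.simps(2)[of W l S x i] by (metis commute)
  also have "\<rho> (S (km x i)) (S (km x (i + Suc n))) \<le> (a + S') * r"
    using S_le[OF km_closed km_closed, OF x x] km_dist_le_sum[OF x, of i "Suc n"]
    unfolding sum_eq r_def by (rule order_trans)
  finally have main: "(1 + S') * r1 \<le> (1 - a) * D + a * ((a + S') * r) + P' * (r1 - re)"
    using a by (simp add: mult_left_mono)
  have "1 + S' \<le> P'"
    unfolding S'_def P'_def by (rule one_plus_sum_le_prod_inverse) (rule l_range)
  moreover have "r1 \<le> r" using residual_Suc_le[OF x] by (simp add: r1_def r_def)
  \<comment> \<open>The coefficient \<open>1 + S' - P'\<close> is nonpositive, so passing from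
    \<open>r1\<close> to the larger \<open>r\<close> reverses the inequality. Afterwards a factor
    \<open>1 - a\<close> splits off.\<close>
  ultimately have "(1 + S' - P') * r \<le> (1 + S' - P') * r1"
    by (intro mult_left_mono_neg) auto
  with main have "(1 - a) * ((1 + (a + S')) * r) \<le> (1 - a) * D + P' * (r - re)"
    by (simp add: algebra_simps)
  also have "\<dots> = (1 - a) * (D + P' / (1 - a) * (r - re))"
    using a by (simp add: field_simps)
  finally have "(1 + (a + S')) * r \<le> D + P' / (1 - a) * (r - re)"
    using a by simp
  then show ?case by (simp only: sum_eq prod_eq D_def r_def re_def)
qed

text \<open>On the block the product is at most \<open>exp (k * (A + 1))\<close>. A drop smaller
  than its reciprocal would make the last term of the Goebel-Kirk inequality at most one, hence
  \<open>(1 + A) * residual x i \<le> D + 1\<close>, against \<open>big\<close>.\<close>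

lemma residual_drop:
  assumes x: "x \<in> C" and k: "0 < k" "\<And>n. l n \<le> 1 - 1 / k"
    and block: "A \<le> sum l {i..<i + n}" "sum l {i..<i + n} \<le> A + 1"
    and D: "\<rho> (km x i) (km x (i + n)) + residual x (i + n) \<le> D"
    and big: "D + 1 < (1 + A) * residual x i"
  shows "residual x (i + n) \<le> residual x i - exp (- k * (A + 1))"
proof (rule ccontr)
  assume "\<not> ?thesis"
  then have small: "residual x i - residual x (i + n) < exp (- k * (A + 1))" by simp
  have diff: "0 \<le> residual x i - residual x (i + n)"
    using residual_antimono[OF x, of i "i + n"] by simp
  have "(\<Prod>s=i..<i + n. 1 / (1 - l s)) \<le> (\<Prod>s=i..<i + n. exp (k * l s))"
    using l_range k by (intro prod_mono conjI inverse_one_minus_le_exp) (auto simp: less_imp_le)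
  also have "\<dots> = exp (k * sum l {i..<i + n})"
    by (simp add: exp_sum sum_distrib_left)
  also have "\<dots> \<le> exp (k * (A + 1))" using block k by simp
  finally have P: "(\<Prod>s=i..<i + n. 1 / (1 - l s)) \<le> exp (k * (A + 1))" .
  have "(1 + A) * residual x i \<le> (1 + sum l {i..<i + n}) * residual x i"
    using block residual_nonneg by (intro mult_right_mono) auto
  also have "\<dots> \<le> \<rho> (km x i) (S (km x (i + n)))
        + (\<Prod>s=i..<i + n. 1 / (1 - l s)) * (residual x i - residual x (i + n))"
    by (rule Goebel_Kirk_inequality[OF x])
  also have "\<dots> \<le> D + exp (k * (A + 1)) * exp (- k * (A + 1))"
  proof (rule add_mono)
    show "\<rho> (km x i) (S (km x (i + n))) \<le> D"
      using triangle[of "km x i" "km x (i + n)" "S (km x (i + n))"] km_in_X x D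
      by (simp add: residual_def)
    show "(\<Prod>s=i..<i + n. 1 / (1 - l s)) * (residual x i - residual x (i + n))
        \<le> exp (k * (A + 1)) * exp (- k * (A + 1))"
      using P small diff by (intro mult_mono) auto
  qed
  also have "\<dots> = D + 1" by (simp flip: exp_add)
  finally show False using big by simp
qed

end

section \<open>A uniform index for small residuals\<close>

text \<open>The index \<open>N\<close> is obtained before the space, the map and the starting point
  are quantified. This order is what lets one index serve all slices at once.\<close>

lemma uniform_asymptotic_regularity:
  fixes l :: "nat \<Rightarrow> real"
  assumes l: "\<And>n. l n \<in> {0..<1}" and k: "0 < k" "\<And>n. l n \<le> 1 - 1 / k"
    and div: "\<And>B. \<exists>m. B \<le> sum l {..<m}" and B: "0 \<le> B" and e: "0 < e"
  obtains N where "\<And>X (\<rho> :: 'a \<Rightarrow> 'a \<Rightarrow> real) W C S x. \<lbrakk>KM_setting X \<rho> W C S l; x \<in> C;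
      \<And>m p. \<rho> (KM_iteration W l S x m) (KM_iteration W l S x p) \<le> B\<rbrakk>
    \<Longrightarrow> \<rho> (KM_iteration W l S x N) (S (KM_iteration W l S x N)) \<le> e"
proof -
  obtain j where j: "0 < l j"
  proof -
    obtain m where "1 \<le> sum l {..<m}" using div by blast
    then have "\<not> (\<forall>i. l i \<le> 0)"
      by (metis not_one_le_zero order.trans sum_nonpos)
    then show ?thesis using that by (meson not_le)
  qed
  \<comment> \<open>The step at \<open>j\<close> has length \<open>l j\<close> times the residual
    and is at most \<open>B\<close>, so \<open>R\<close> bounds the residual from \<open>j\<close>
    on.\<close>
  define R where "R = B / l j"
  define D where "D = B + R"
  \<comment> \<open>Chosen so that \<open>D + 1 < (1 + A) * e\<close>, which is \<open>big\<close>
    in \<open>residual_drop\<close> whenever the residual exceeds \<open>e\<close>.\<close>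
  define A where "A = (D + 1) / e"
  define h where "h = exp (- k * (A + 1))"
  have R: "0 \<le> R" using B j by (simp add: R_def)
  have A: "0 \<le> A" using R B e by (simp add: A_def D_def)
  have h: "0 < h" by (simp add: h_def)
  define good where "good x \<rho> W C S \<longleftrightarrow> (\<exists>X. KM_setting X \<rho> W C S l) \<and> x \<in> C \<and>
      (\<forall>m p. \<rho> (KM_iteration W l S x m) (KM_iteration W l S x p) \<le> B)"
    for x and \<rho> :: "'a \<Rightarrow> 'a \<Rightarrow> real" and W C S
  define res where "res x \<rho> W S n = \<rho> (KM_iteration W l S x n) (S (KM_iteration W l S x n))"
    for x and \<rho> :: "'a \<Rightarrow> 'a \<Rightarrow> real" and W S n
  \<comment> \<open>After \<open>q\<close> blocks the residual is at most \<open>e\<close> or has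
    dropped \<open>q\<close> times by \<open>h\<close>. The condition \<open>j \<le> N\<close> keeps
    the bound \<open>R\<close> available.\<close>
  have step: "\<exists>N\<ge>j. \<forall>x \<rho> W C S. good x \<rho> W C S \<longrightarrow> res x \<rho> W S N \<le> max e (R - real q * h)" for q
  proof (induction q)
    case 0
    have "res x \<rho> W S j \<le> R" if "good x \<rho> W C S" for x \<rho> W C S
    proof -
      from that obtain X where "KM_setting X \<rho> W C S l" and x: "x \<in> C"
        and bd: "\<And>m p. \<rho> (KM_iteration W l S x m) (KM_iteration W l S x p) \<le> B"
        unfolding good_def by blast
      then interpret KM_setting X \<rho> W C S l by simp
      have "l j * residual x j \<le> B" using bd[of j "Suc j"] km_step_eq[OF x] by metis
      then show ?thesis using j by (simp add: R_def res_def residual_def field_simps)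
    qed
    then show ?case by (intro exI[of _ j]) (fastforce simp: le_max_iff_disj)
  next
    case (Suc q)
    then obtain N where N: "j \<le> N"
      and IH: "\<And>x \<rho> W C S. good x \<rho> W C S \<Longrightarrow> res x \<rho> W S N \<le> max e (R - real q * h)"
      by blast
    obtain n where n: "A \<le> sum l {N..<N + n}" "sum l {N..<N + n} \<le> A + 1"
      using exists_block_of_sum[OF l div A] by blast
    have "res x \<rho> W S (N + n) \<le> max e (R - real (Suc q) * h)" if g: "good x \<rho> W C S" for x \<rho> W C S
    proof -
      from g obtain X where "KM_setting X \<rho> W C S l" and x: "x \<in> C"
        and bd: "\<And>m p. \<rho> (KM_iteration W l S x m) (KM_iteration W l S x p) \<le> B"
        unfolding good_def by blast
      then interpret KM_setting X \<rho> W C S l by simp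
      have res: "res x \<rho> W S m = residual x m" for m by (simp add: res_def residual_def)
      have mono: "residual x (N + n) \<le> residual x N" by (rule residual_antimono[OF x]) simp
      show ?thesis
      proof (cases "residual x N \<le> e")
        case True
        then show ?thesis using mono by (simp add: res)
      next
        case False
        have "l j * residual x j \<le> B" using bd[of j "Suc j"] km_step_eq[OF x] by metis
        then have "residual x j \<le> R" using j by (simp add: R_def field_simps)
        then have "residual x (N + n) \<le> R"
          using residual_antimono[OF x, of j "N + n"] N by simp
        then have D: "\<rho> (km x N) (km x (N + n)) + residual x (N + n) \<le> D"
          unfolding D_def using bd by (intro add_mono)
        have "D + 1 = A * e" using e by (simp add: A_def)
        also have "\<dots> < (1 + A) * e" using e by (simp add: algebra_simps)
        also have "\<dots> \<le> (1 + A) * residual x N" using False A by (intro mult_left_mono) auto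
        finally have "residual x (N + n) \<le> residual x N - h"
          unfolding h_def using residual_drop[OF x k n D] by blast
        moreover have "residual x N \<le> R - real q * h" using IH[OF g] False by (simp add: res)
        ultimately show ?thesis by (simp add: res algebra_simps le_max_iff_disj)
      qed
    qed
    then show ?case using N by (intro exI[of _ "N + n"]) auto
  qed
  obtain q :: nat where q: "R / h < real q" using reals_Archimedean2 by blast
  then have "R - real q * h \<le> e" using h e by (simp add: field_simps)
  moreover obtain N where "\<And>x \<rho> W C S. good x \<rho> W C S \<Longrightarrow> res x \<rho> W S N \<le> max e (R - real q * h)"
    using step[of q] by blast
  ultimately have N: "\<And>x \<rho> W C S. good x \<rho> W C S \<Longrightarrow> res x \<rho> W S N \<le> e"
    by (simp add: max_def)
  show ?thesis
    by (rule that[of N]) (rule N[unfolded good_def res_def], blast)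
qed

section \<open>Dependence of the iterates on the parameter in \<open>M\<close>\<close>

text \<open>If \<open>x\<close> is nonexpansive, the points \<open>(x u, u)\<close> and
  \<open>(x v, v)\<close> have maximum distance exactly \<open>d u v\<close>. So the first component
  of \<open>T (x u, u)\<close> is nonexpansive in \<open>u\<close>, and \<open>W4\<close> passes
  this to the next iterate.\<close>

lemma nonexpansive_KM_iteration_of_slices:
  assumes "hyperbolic_space X \<rho> W" and "C \<subseteq> X" and "W_convex W C"
    and \<delta>: "nonexpansive M d C \<rho> \<delta>"
    and T: "nonexpansive (C \<times> M) (dist_max \<rho> d) (C \<times> M) (dist_max \<rho> d) T"
    and l: "\<And>n. l n \<in> {0..1}"
  shows "nonexpansive M d C \<rho> (\<lambda>u. KM_iteration W l (slice_map T u) (\<delta> u) n)"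
proof (induction n)
  case 0
  then show ?case using \<delta> by simp
next
  case (Suc n)
  interpret hyperbolic_space X \<rho> W by fact
  define x where "x u = KM_iteration W l (slice_map T u) (\<delta> u) n" for u
  have x: "x u \<in> C" and x_le: "v \<in> M \<Longrightarrow> \<rho> (x u) (x v) \<le> d u v" if "u \<in> M" for u v
    using Suc that by (auto simp: nonexpansive_def x_def)
  have Tx: "fst (T (x u, u)) \<in> C" if "u \<in> M" for u
  proof -
    have "T (x u, u) \<in> C \<times> M" using T x[OF that] that by (auto simp: nonexpansive_def)
    then show ?thesis by (simp add: mem_Times_iff)
  qed
  have Tx_le: "\<rho> (fst (T (x u, u))) (fst (T (x v, v))) \<le> d u v" if "u \<in> M" "v \<in> M" for u v
  proof -
    have "dist_max \<rho> d (T (x u, u)) (T (x v, v)) \<le> dist_max \<rho> d (x u, u) (x v, v)"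
      using T x that by (auto simp: nonexpansive_def)
    then show ?thesis using x_le that by (simp add: dist_max_def)
  qed
  have "W (x u) (fst (T (x u, u))) (l n) \<in> C" if "u \<in> M" for u
    using assms(3) x Tx that l by (simp add: W_convex_def)
  moreover have "\<rho> (W (x u) (fst (T (x u, u))) (l n)) (W (x v) (fst (T (x v, v))) (l n)) \<le> d u v"
    if "u \<in> M" "v \<in> M" for u v
  proof -
    have "\<rho> (W (x u) (fst (T (x u, u))) (l n)) (W (x v) (fst (T (x v, v))) (l n))
        \<le> (1 - l n) * \<rho> (x u) (x v) + l n * \<rho> (fst (T (x u, u))) (fst (T (x v, v)))"
      using x Tx that l \<open>C \<subseteq> X\<close> by (intro W4) auto
    also have "\<dots> \<le> (1 - l n) * d u v + l n * d u v"
      using l[of n] x_le Tx_le that by (intro add_mono mult_left_mono) auto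
    finally show ?thesis by (simp add: algebra_simps)
  qed
  moreover have "KM_iteration W l (slice_map T u) (\<delta> u) (Suc n) = W (x u) (fst (T (x u, u))) (l n)"
    for u by (simp add: x_def slice_map_def)
  ultimately show ?case by (simp only: nonexpansive_def Pi_iff) blast
qed

section \<open>Approximate fixed points in the product\<close>

theorem theorem2p4:
  fixes X C :: "'a set" and \<rho> :: "'a \<Rightarrow> 'a \<Rightarrow> real" and W :: "'a \<Rightarrow> 'a \<Rightarrow> real \<Rightarrow> 'a"
    and M :: "'b set" and d :: "'b \<Rightarrow> 'b \<Rightarrow> real"
    and \<delta> :: "'b \<Rightarrow> 'a" and T :: "'a \<times> 'b \<Rightarrow> 'a \<times> 'b"
    and l :: "nat \<Rightarrow> real" and K :: nat and \<alpha> :: "nat \<Rightarrow> nat"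
  assumes "hyperbolic_space X \<rho> W"
    and "C \<subseteq> X" and "C \<noteq> {}" and "W_convex W C"
    and "Metric_space M d" and "AFPP M d"
    and "nonexpansive M d C \<rho> \<delta>"
    and "nonexpansive (C \<times> M) (dist_max \<rho> d) (C \<times> M) (dist_max \<rho> d) T"
    and "\<And>n. l n \<in> {0..<1}"
    and "K \<ge> 1"
    and "\<And>n. l n \<le> 1 - 1 / real K"
    and "\<And>n. real n \<le> (\<Sum>i=0..\<alpha> n. l i)"
    and "\<exists>b>0. \<forall>u\<in>M. \<exists>y\<in>C. \<rho> (\<delta> u) y \<le> b \<and>
           (\<forall>m p. \<rho> (KM_iteration W l (slice_map T u) y m)
                     (KM_iteration W l (slice_map T u) y p) \<le> b)"
  shows "min_displacement (C \<times> M) (dist_max \<rho> d) T = 0"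
proof -
  interpret hyperbolic_space X \<rho> W by fact
  interpret M: Metric_space M d by fact
  obtain b where b: "0 < b" and start: "\<And>u. u \<in> M \<Longrightarrow> \<exists>y\<in>C. \<rho> (\<delta> u) y \<le> b \<and>
      (\<forall>m p. \<rho> (KM_iteration W l (slice_map T u) y m) (KM_iteration W l (slice_map T u) y p) \<le> b)"
    using assms(13) by blast
  have T_closed: "T p \<in> C \<times> M" if "p \<in> C \<times> M" for p
    using assms(8) that by (auto simp: nonexpansive_def)
  have T_le: "dist_max \<rho> d (T p) (T q) \<le> dist_max \<rho> d p q" if "p \<in> C \<times> M" "q \<in> C \<times> M" for p q
    using assms(8) that by (auto simp: nonexpansive_def)
  have slice: "KM_setting X \<rho> W C (slice_map T u) l" if u: "u \<in> M" for u
  proof unfold_locales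
    show "nonexpansive C \<rho> C \<rho> (slice_map T u)"
      unfolding nonexpansive_def
    proof (intro conjI ballI funcsetI)
      fix x assume "x \<in> C"
      then show "slice_map T u x \<in> C" using T_closed[of "(x, u)"] u
        by (auto simp: slice_map_def mem_Times_iff)
    next
      fix x y assume "x \<in> C" "y \<in> C"
      then have "dist_max \<rho> d (T (x, u)) (T (y, u)) \<le> \<rho> x y"
        using T_le[of "(x, u)" "(y, u)"] u by (simp add: dist_max_def)
      then show "\<rho> (slice_map T u x) (slice_map T u y) \<le> \<rho> x y"
        by (simp add: dist_max_def slice_map_def)
    qed
  qed (use assms in auto)
  have \<delta>: "\<delta> u \<in> C" if "u \<in> M" for u
    using assms(7) that by (auto simp: nonexpansive_def)
  \<comment> \<open>The constant is \<open>b + b + b\<close>: from the iteration at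
    \<open>\<delta> u\<close> to the one at \<open>y\<close>, along the latter, and back.\<close>
  have bound: "\<rho> (KM_iteration W l (slice_map T u) (\<delta> u) m)
      (KM_iteration W l (slice_map T u) (\<delta> u) p) \<le> 3 * b" if u: "u \<in> M" for u m p
  proof -
    interpret KM_setting X \<rho> W C "slice_map T u" l using slice[OF u] .
    obtain y where y: "y \<in> C" "\<rho> (\<delta> u) y \<le> b" "\<rho> (km y m) (km y p) \<le> b"
      using start[OF u] by blast
    have close: "\<rho> (km (\<delta> u) n) (km y n) \<le> b" for n
      using km_dist_le[OF \<delta>[OF u] y(1), of n] y(2) by linarith
    note in_X = km_in_X(1)[OF \<delta>[OF u]] km_in_X(1)[OF y(1)]
    have "\<rho> (km (\<delta> u) m) (km (\<delta> u) p) \<le> \<rho> (km (\<delta> u) m) (km y m) + \<rho> (km y m) (km (\<delta> u) p)"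
      using triangle in_X by blast
    also have "\<rho> (km y m) (km (\<delta> u) p) \<le> \<rho> (km y m) (km y p) + \<rho> (km y p) (km (\<delta> u) p)"
      using triangle in_X by blast
    finally show ?thesis using close[of m] close[of p] y(3) commute[of "km y p"] by simp
  qed
  have div: "\<exists>m. B \<le> sum l {..<m}" for B
  proof -
    obtain n where "B \<le> real n" using real_arch_simple by blast
    also have "real n \<le> sum l {..<Suc (\<alpha> n)}"
      using assms(12)[of n] by (simp only: lessThan_Suc_atMost atLeast0AtMost)
    finally show ?thesis by blast
  qed
  have ex: "\<exists>p\<in>C \<times> M. dist_max \<rho> d p (T p) \<le> e" if e: "0 < e" for e
  proof -
    have "0 < real K" "0 \<le> 3 * b" using assms(10) b by auto
    then obtain N where N: "\<And>X (\<rho> :: 'a \<Rightarrow> 'a \<Rightarrow> real) W C S x. \<lbrakk>KM_setting X \<rho> W C S l; x \<in> C;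
        \<And>m p. \<rho> (KM_iteration W l S x m) (KM_iteration W l S x p) \<le> 3 * b\<rbrakk>
      \<Longrightarrow> \<rho> (KM_iteration W l S x N) (S (KM_iteration W l S x N)) \<le> e"
      using uniform_asymptotic_regularity[OF assms(9) _ assms(11) div _ e, of "3 * b"] by blast
    define x where "x u = KM_iteration W l (slice_map T u) (\<delta> u) N" for u
    have C_small: "\<rho> (x u) (fst (T (x u, u))) \<le> e" if "u \<in> M" for u
    proof -
      have "\<rho> (x u) (slice_map T u (x u)) \<le> e"
        unfolding x_def by (rule N[OF slice \<delta> bound, OF that that that])
      then show ?thesis by (simp add: slice_map_def)
    qed
    have "l n \<in> {0..1}" for n using assms(9)[of n] by simp
    then have x_nonexp: "nonexpansive M d C \<rho> x"
      unfolding x_def using assms by (intro nonexpansive_KM_iteration_of_slices)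
    \<comment> \<open>With \<open>N\<close> fixed, this is a single self-map of \<open>M\<close>. An
      approximate fixed point \<open>u\<close> of it makes both components of the displacement at
      \<open>(x u, u)\<close> small.\<close>
    have "nonexpansive M d M d (\<lambda>u. snd (T (x u, u)))"
      unfolding nonexpansive_def
    proof (intro conjI ballI funcsetI)
      fix u assume "u \<in> M"
      then show "snd (T (x u, u)) \<in> M"
        using T_closed[of "(x u, u)"] x_nonexp by (auto simp: nonexpansive_def mem_Times_iff)
    next
      fix u v assume uv: "u \<in> M" "v \<in> M"
      then have "dist_max \<rho> d (T (x u, u)) (T (x v, v)) \<le> d u v"
        using T_le[of "(x u, u)" "(x v, v)"] x_nonexp
        by (auto simp: nonexpansive_def dist_max_def[of _ _ "(_, _)"])
      then show "d (snd (T (x u, u))) (snd (T (x v, v))) \<le> d u v"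
        by (simp add: dist_max_def)
    qed
    then obtain w :: "nat \<Rightarrow> 'b" where w: "range w \<subseteq> M"
      and lim: "(\<lambda>n. d (w n) (snd (T (x (w n), w n)))) \<longlonglongrightarrow> 0"
      using assms(6) unfolding AFPP_def by blast
    obtain n where n: "d (w n) (snd (T (x (w n), w n))) < e"
      using order_tendstoD(2)[OF lim e] by (auto simp: eventually_sequentially)
    have wn: "w n \<in> M" using w by blast
    show ?thesis
    proof (rule bexI[of _ "(x (w n), w n)"])
      show "dist_max \<rho> d (x (w n), w n) (T (x (w n), w n)) \<le> e"
        using C_small[OF wn] n by (simp add: dist_max_def)
      show "(x (w n), w n) \<in> C \<times> M"
        using x_nonexp wn by (auto simp: nonexpansive_def)
    qed
  qed
  have nonneg': "0 \<le> dist_max \<rho> d p (T p)" for p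
    by (simp add: dist_max_def le_max_iff_disj)
  show ?thesis
    unfolding min_displacement_def
  proof (rule antisym)
    show "(INF p\<in>C \<times> M. dist_max \<rho> d p (T p)) \<le> 0"
    proof (rule field_le_epsilon)
      fix e :: real assume "0 < e"
      then obtain p where "p \<in> C \<times> M" "dist_max \<rho> d p (T p) \<le> e" using ex by blast
      moreover have "bdd_below ((\<lambda>p. dist_max \<rho> d p (T p)) ` (C \<times> M))"
        using nonneg' by (intro bdd_belowI2)
      ultimately show "(INF p\<in>C \<times> M. dist_max \<rho> d p (T p)) \<le> 0 + e"
        by (simp add: cINF_lower2)
    qed
    show "0 \<le> (INF p\<in>C \<times> M. dist_max \<rho> d p (T p))"
      \<comment> \<open>\<open>ex[of 1]\<close> supplies the nonemptiness of
        \<open>C \<times> M\<close>, which a lower bound for a real infimum requires.\<close>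
      using ex[of 1] nonneg' by (intro cINF_greatest) auto
  qed
qed

end
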